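(* Suppose that $\Psi(\Theta)$ is finite, with $\nu_\Psi$ equal to counting measure on $\Psi(\Theta)$, and that $\pi_\Psi(\psi)>0$ for every $\psi\in\Psi(\Theta)$. Then for the loss function $$L_{RB}(\theta,\psi)=\frac{I_{\{\psi\}^c}(\Psi(\theta))}{\pi_\Psi(\Psi(\theta))},\qquad \theta\in\Theta,\ \psi\in\Psi(\Theta),$$ the relative belief estimator $\psi_{RB}$, where $\psi_{RB}(x)=\arg\sup_{\psi\in\Psi(\Theta)}RB_\Psi(\psi\,|\,x)$, is a Bayes rule.
   Context: Setting. $\{f(\cdot\,|\,\theta):\theta\in\Theta\}$ is a family of probability densities on a sample space $\mathcal X$ with respect to a support measure $\mu$; $\pi$ is a proper prior density on $\Theta$ with respect to a support measure $\nu$, with associated probability measure $\Pi$. The prior predictive density is $m(x)=\int_\Theta \pi(\theta)f(x\,|\,\theta)\,\nu(d\theta)$, with probability measure $M$ on $\mathcal X$, and the posterior density is $\pi(\theta\,|\,x)=\pi(\theta)f(x\,|\,\theta)/m(x)$; $x$ is restricted to points with $0<m(x)<\infty$ (which is $M$-almost all of $\mathcal X$). $\Psi:\Theta\to\Psi(\Theta)$ is a (measurable) parameter of interest, with marginal prior $\Pi_\Psi$ and marginal posterior $\Pi_\Psi(\cdot\,|\,x)$ on $\Psi(\Theta)$, having densities $\pi_\Psi$ and $\pi_\Psi(\cdot\,|\,x)$ with respect to $\nu_\Psi$. Let $m(x\,|\,\psi)=\int_\Theta f(x\,|\,\theta)\,\Pi(d\theta\,|\,\psi)$, where $\Pi(\cdot\,|\,\psi)$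 is the conditional prior of $\theta$ given $\Psi(\theta)=\psi$, with probability measure $M(\cdot\,|\,\psi)$. The relative belief ratio is $$RB_\Psi(\psi\,|\,x)=\frac{\pi_\Psi(\psi\,|\,x)}{\pi_\Psi(\psi)}=\frac{m(x\,|\,\psi)}{m(x)}.$$ $\psi_{RB}$ is any (measurable) map with $\psi_{RB}(x)$ a maximizer of $RB_\Psi(\cdot\,|\,x)$ for each $x$. $I_A$ is the indicator function of a set $A$. Bayes rules. A loss $L(\theta,\psi)$ depends on $\theta$ only through $\Psi(\theta)$, so it may be regarded as a function on $\Psi(\Theta)\times\Psi(\Theta)$. The prior risk of a decision function $\delta:\mathcal X\to\Psi(\Theta)$ is $r(\delta)=\int_{\Psi(\Theta)}\int_{\mathcal X}L(\psi,\delta(x))\,M(dx\,|\,\psi)\,\Pi_\Psi(d\psi)=\int_{\mathcal X} r(\delta\,|\,x)\,M(dx)$, where $r(\delta\,|\,x)=\int_{\Psi(\Theta)}L(\psi,\delta(x))\,\Pi_\Psi(d\psi\,|\,x)$ is the posterior risk. A Bayes rule is a decision function minimizing $r(\delta)$. *)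

theory Defs
  imports "HOL-Probability.Probability"
begin

text \<open>
  Densities are real-valued; integrals of them take values in \<open>ennreal\<close>, since the prior
  predictive density may be infinite at some points. The parameter space is \<open>space \<nu>\<close>, the
  sample space is \<open>space \<mu>\<close>, and \<open>f \<theta> x\<close> stands for $f(x\,|\,\theta)$. Only \<open>\<mu>\<close> has to be
  sigma-finite, because \<open>\<nu>\<close> enters solely through the prior probability measure.
\<close>

locale bayes_model = sigma_finite_measure \<mu>
  for \<mu> :: "'x measure" +
  fixes \<nu> :: "'t measure"
    and f :: "'t \<Rightarrow> 'x \<Rightarrow> real"
    and \<pi> :: "'t \<Rightarrow> real"
    and \<Psi> :: "'t \<Rightarrow> 'c"
    and \<nu>\<Psi> :: "'c measure"
  assumes f_measurable: "(\<lambda>(\<theta>, x). f \<theta> x) \<in> borel_measurable (\<nu> \<Otimes>\<^sub>M \<mu>)"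
    and f_nonneg: "\<And>\<theta> x. \<theta> \<in> space \<nu> \<Longrightarrow> x \<in> space \<mu> \<Longrightarrow> 0 \<le> f \<theta> x"
    and f_density: "\<And>\<theta>. \<theta> \<in> space \<nu> \<Longrightarrow> prob_space (density \<mu> (\<lambda>x. ennreal (f \<theta> x)))"
    and prior_measurable: "\<pi> \<in> borel_measurable \<nu>"
    and prior_nonneg: "\<And>\<theta>. \<theta> \<in> space \<nu> \<Longrightarrow> 0 \<le> \<pi> \<theta>"
    and prior_proper: "prob_space (density \<nu> (\<lambda>\<theta>. ennreal (\<pi> \<theta>)))"
    and Psi_measurable: "\<Psi> \<in> measurable \<nu> \<nu>\<Psi>"
    and space_nu_Psi: "space \<nu>\<Psi> = \<Psi> ` space \<nu>"

definition prior :: "'t measure \<Rightarrow> ('t \<Rightarrow> real) \<Rightarrow> 't measure" where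
  "prior \<nu> \<pi> = density \<nu> (\<lambda>\<theta>. ennreal (\<pi> \<theta>))"

definition prior_predictive ::
  "'t measure \<Rightarrow> ('t \<Rightarrow> 'x \<Rightarrow> real) \<Rightarrow> ('t \<Rightarrow> real) \<Rightarrow> 'x \<Rightarrow> ennreal" where
  "prior_predictive \<nu> f \<pi> x = (\<integral>\<^sup>+ \<theta>. ennreal (\<pi> \<theta> * f \<theta> x) \<partial>\<nu>)"

text \<open>Meaningful only at points \<open>x\<close> with \<open>0 < prior_predictive \<nu> f \<pi> x < \<infinity>\<close>.\<close>

definition posterior ::
  "'t measure \<Rightarrow> ('t \<Rightarrow> 'x \<Rightarrow> real) \<Rightarrow> ('t \<Rightarrow> real) \<Rightarrow> 'x \<Rightarrow> 't measure" where
  "posterior \<nu> f \<pi> x =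
     density \<nu> (\<lambda>\<theta>. ennreal (\<pi> \<theta> * f \<theta> x) / prior_predictive \<nu> f \<pi> x)"

definition marginal_prior ::
  "'t measure \<Rightarrow> ('t \<Rightarrow> real) \<Rightarrow> ('t \<Rightarrow> 'c) \<Rightarrow> 'c measure \<Rightarrow> 'c measure" where
  "marginal_prior \<nu> \<pi> \<Psi> \<nu>\<Psi> = distr (prior \<nu> \<pi>) \<nu>\<Psi> \<Psi>"

definition marginal_posterior ::
  "'t measure \<Rightarrow> ('t \<Rightarrow> 'x \<Rightarrow> real) \<Rightarrow> ('t \<Rightarrow> real) \<Rightarrow> ('t \<Rightarrow> 'c) \<Rightarrow> 'c measure \<Rightarrow> 'x
     \<Rightarrow> 'c measure" where
  "marginal_posterior \<nu> f \<pi> \<Psi> \<nu>\<Psi> x = distr (posterior \<nu> f \<pi> x) \<nu>\<Psi> \<Psi>"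

text \<open>
  A Radon-Nikodym derivative is in general only determined almost everywhere; with respect to
  counting measure on a countable set it is determined at every point.
\<close>

definition marginal_prior_density ::
  "'t measure \<Rightarrow> ('t \<Rightarrow> real) \<Rightarrow> ('t \<Rightarrow> 'c) \<Rightarrow> 'c measure \<Rightarrow> 'c \<Rightarrow> ennreal" where
  "marginal_prior_density \<nu> \<pi> \<Psi> \<nu>\<Psi> = RN_deriv \<nu>\<Psi> (marginal_prior \<nu> \<pi> \<Psi> \<nu>\<Psi>)"

definition marginal_posterior_density ::
  "'t measure \<Rightarrow> ('t \<Rightarrow> 'x \<Rightarrow> real) \<Rightarrow> ('t \<Rightarrow> real) \<Rightarrow> ('t \<Rightarrow> 'c) \<Rightarrow> 'c measure \<Rightarrow> 'x
     \<Rightarrow> 'c \<Rightarrow> ennreal" where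
  "marginal_posterior_density \<nu> f \<pi> \<Psi> \<nu>\<Psi> x =
     RN_deriv \<nu>\<Psi> (marginal_posterior \<nu> f \<pi> \<Psi> \<nu>\<Psi> x)"

definition relative_belief_ratio ::
  "'t measure \<Rightarrow> ('t \<Rightarrow> 'x \<Rightarrow> real) \<Rightarrow> ('t \<Rightarrow> real) \<Rightarrow> ('t \<Rightarrow> 'c) \<Rightarrow> 'c measure \<Rightarrow> 'c
     \<Rightarrow> 'x \<Rightarrow> ennreal" where
  "relative_belief_ratio \<nu> f \<pi> \<Psi> \<nu>\<Psi> \<psi> x =
     marginal_posterior_density \<nu> f \<pi> \<Psi> \<nu>\<Psi> x \<psi> / marginal_prior_density \<nu> \<pi> \<Psi> \<nu>\<Psi> \<psi>"

text \<open>
  Conditioning of the prior on \<open>\<Psi> \<theta> = \<psi>\<close>, in the elementary sense; this requires that the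
  event has positive prior probability.
\<close>

definition conditional_prior ::
  "'t measure \<Rightarrow> ('t \<Rightarrow> real) \<Rightarrow> ('t \<Rightarrow> 'c) \<Rightarrow> 'c \<Rightarrow> 't measure" where
  "conditional_prior \<nu> \<pi> \<Psi> \<psi> = uniform_measure (prior \<nu> \<pi>) {\<theta> \<in> space \<nu>. \<Psi> \<theta> = \<psi>}"

definition conditional_predictive_density ::
  "'t measure \<Rightarrow> ('t \<Rightarrow> 'x \<Rightarrow> real) \<Rightarrow> ('t \<Rightarrow> real) \<Rightarrow> ('t \<Rightarrow> 'c) \<Rightarrow> 'c \<Rightarrow> 'x \<Rightarrow> ennreal"
  where
  "conditional_predictive_density \<nu> f \<pi> \<Psi> \<psi> x =
     (\<integral>\<^sup>+ \<theta>. ennreal (f \<theta> x) \<partial>conditional_prior \<nu> \<pi> \<Psi> \<psi>)"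

definition conditional_predictive ::
  "'x measure \<Rightarrow> 't measure \<Rightarrow> ('t \<Rightarrow> 'x \<Rightarrow> real) \<Rightarrow> ('t \<Rightarrow> real) \<Rightarrow> ('t \<Rightarrow> 'c) \<Rightarrow> 'c
     \<Rightarrow> 'x measure" where
  "conditional_predictive \<mu> \<nu> f \<pi> \<Psi> \<psi> =
     density \<mu> (conditional_predictive_density \<nu> f \<pi> \<Psi> \<psi>)"

text \<open>
  A loss on \<open>space \<nu> \<times> \<Psi> ` space \<nu>\<close> that depends on \<open>\<theta>\<close> only through \<open>\<Psi> \<theta>\<close>, regarded as a
  function of \<open>\<Psi> \<theta>\<close>: evaluate it at any \<open>\<theta>\<close> in the fibre. Losses are nonnegative, so that
  risks are well defined in \<open>ennreal\<close>.
\<close>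

definition loss_on_Psi ::
  "'t measure \<Rightarrow> ('t \<Rightarrow> 'c) \<Rightarrow> ('t \<Rightarrow> 'c \<Rightarrow> ennreal) \<Rightarrow> 'c \<Rightarrow> 'c \<Rightarrow> ennreal" where
  "loss_on_Psi \<nu> \<Psi> L \<psi> a = L (inv_into (space \<nu>) \<Psi> \<psi>) a"

definition prior_risk ::
  "'x measure \<Rightarrow> 't measure \<Rightarrow> ('t \<Rightarrow> 'x \<Rightarrow> real) \<Rightarrow> ('t \<Rightarrow> real) \<Rightarrow> ('t \<Rightarrow> 'c) \<Rightarrow> 'c measure
     \<Rightarrow> ('t \<Rightarrow> 'c \<Rightarrow> ennreal) \<Rightarrow> ('x \<Rightarrow> 'c) \<Rightarrow> ennreal" where
  "prior_risk \<mu> \<nu> f \<pi> \<Psi> \<nu>\<Psi> L \<delta> =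
     (\<integral>\<^sup>+ \<psi>. (\<integral>\<^sup>+ x. loss_on_Psi \<nu> \<Psi> L \<psi> (\<delta> x) \<partial>conditional_predictive \<mu> \<nu> f \<pi> \<Psi> \<psi>)
        \<partial>marginal_prior \<nu> \<pi> \<Psi> \<nu>\<Psi>)"

definition bayes_rule ::
  "'x measure \<Rightarrow> 't measure \<Rightarrow> ('t \<Rightarrow> 'x \<Rightarrow> real) \<Rightarrow> ('t \<Rightarrow> real) \<Rightarrow> ('t \<Rightarrow> 'c) \<Rightarrow> 'c measure
     \<Rightarrow> ('t \<Rightarrow> 'c \<Rightarrow> ennreal) \<Rightarrow> ('x \<Rightarrow> 'c) \<Rightarrow> bool" where
  "bayes_rule \<mu> \<nu> f \<pi> \<Psi> \<nu>\<Psi> L \<delta> \<longleftrightarrow>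
     \<delta> \<in> measurable \<mu> \<nu>\<Psi> \<and>
     (\<forall>\<delta>' \<in> measurable \<mu> \<nu>\<Psi>.
        prior_risk \<mu> \<nu> f \<pi> \<Psi> \<nu>\<Psi> L \<delta> \<le> prior_risk \<mu> \<nu> f \<pi> \<Psi> \<nu>\<Psi> L \<delta>')"

definition loss_RB ::
  "'t measure \<Rightarrow> ('t \<Rightarrow> real) \<Rightarrow> ('t \<Rightarrow> 'c) \<Rightarrow> 'c measure \<Rightarrow> 't \<Rightarrow> 'c \<Rightarrow> ennreal" where
  "loss_RB \<nu> \<pi> \<Psi> \<nu>\<Psi> \<theta> \<psi> =
     indicator (- {\<psi>}) (\<Psi> \<theta>) / marginal_prior_density \<nu> \<pi> \<Psi> \<nu>\<Psi> (\<Psi> \<theta>)"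

text \<open>
  No condition is imposed where the posterior is undefined, a null set under the prior
  predictive distribution.
\<close>

definition relative_belief_estimator ::
  "'x measure \<Rightarrow> 't measure \<Rightarrow> ('t \<Rightarrow> 'x \<Rightarrow> real) \<Rightarrow> ('t \<Rightarrow> real) \<Rightarrow> ('t \<Rightarrow> 'c) \<Rightarrow> 'c measure
     \<Rightarrow> ('x \<Rightarrow> 'c) \<Rightarrow> bool" where
  "relative_belief_estimator \<mu> \<nu> f \<pi> \<Psi> \<nu>\<Psi> \<delta> \<longleftrightarrow>
     \<delta> \<in> measurable \<mu> \<nu>\<Psi> \<and>
     (\<forall>x \<in> space \<mu>. 0 < prior_predictive \<nu> f \<pi> x \<and> prior_predictive \<nu> f \<pi> x < \<infinity> \<longrightarrow>
        is_arg_max (\<lambda>\<psi>. relative_belief_ratio \<nu> f \<pi> \<Psi> \<nu>\<Psi> \<psi> x) (\<lambda>\<psi>. \<psi> \<in> \<Psi> ` space \<nu>) (\<delta> x))"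

end

theory Submission
  imports Defs
begin

text \<open>
  The loss charges a wrong answer the reciprocal of the prior mass of the true value \<open>\<psi>\<close>. In the
  prior risk this cancels the weight that the marginal prior gives to \<open>\<psi>\<close>, so all values count
  equally: by Tonelli,
  \[ r(\delta) = \int \sum_{\psi \neq \delta(x)} m(x\,|\,\psi)\,\mu(dx), \]
  which is \<open>prior_risk_loss_RB\<close>. The integrand is smallest when the omitted term
  $m(x\,|\,\delta(x))$ is largest, and this minimisation can be done separately at each \<open>x\<close>.
  Since $RB(\psi\,|\,x) = m(x\,|\,\psi)/m(x)$ (\<open>relative_belief_ratio_eq\<close>), with a denominator
  free of \<open>\<psi>\<close>, a maximiser of the relative belief ratio is a maximiser of $m(x\,|\,\cdot)$.

  The risk is an integral over \<open>\<mu>\<close> rather than over the prior predictive distribution, so points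
  where the posterior is undefined need a separate argument. Where
  \<open>m(x) = 0\<close>, every $m(x\,|\,\psi)$ vanishes (\<open>cond_pred_zero\<close>) and the value of the estimator
  does not influence the integrand. The set where \<open>m(x) = \<infinity>\<close> is \<open>\<mu>\<close>-null, because \<open>m\<close> integrates
  to 1 (\<open>AE_prior_predictive_finite\<close>).
\<close>

section \<open>Counting measure and finite sums\<close>

text \<open>
  The empty set is the only null set of counting measure, so every measure on \<open>C\<close> is absolutely
  continuous and its density is determined at each point.
\<close>

lemma RN_deriv_count_space:
  assumes "countable C" and "sets N = Pow C" and "c \<in> C"
  shows "RN_deriv (count_space C) N c = emeasure N {c}"
proof -
  interpret sigma_finite_measure "count_space C"
    by (rule sigma_finite_measure_count_space_countable) fact
  have "density (count_space C) (RN_deriv (count_space C) N) = N"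
    by (rule density_RN_deriv)
      (auto simp: absolutely_continuous_def null_sets_count_space assms(2))
  then have "emeasure N {c} = emeasure (density (count_space C) (RN_deriv (count_space C) N)) {c}"
    by simp
  also have "\<dots> = (\<integral>\<^sup>+y. RN_deriv (count_space C) N c * indicator {c} y \<partial>count_space C)"
    using assms(3) by (auto simp: emeasure_density indicator_def intro!: nn_integral_cong)
  also have "\<dots> = RN_deriv (count_space C) N c"
    using assms(3) by (simp add: nn_integral_cmult_indicator)
  finally show ?thesis by simp
qed

text \<open>The terms outside \<open>{a, b}\<close> are common to both sums, leaving \<open>h b\<close> against \<open>h a\<close>.\<close>

lemma sum_remove_le_sum_remove:
  fixes h :: "'a \<Rightarrow> 'b :: ordered_comm_monoid_add"
  assumes "finite C" "a \<in> C" "b \<in> C" "h b \<le> h a"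
  shows "sum h (C - {a}) \<le> sum h (C - {b})"
proof (cases "a = b")
  case False
  have "sum h (C - {a}) = h b + sum h (C - {a, b})"
    using assms False by (subst sum.remove[of _ b]) (auto simp: Diff_insert2[symmetric] insert_commute)
  also have "\<dots> \<le> h a + sum h (C - {a, b})"
    using assms(4) by (rule add_right_mono)
  also have "\<dots> = sum h (C - {b})"
    using assms False by (subst sum.remove[of "C - {b}" a]) (auto simp: Diff_insert2[symmetric] insert_commute)
  finally show ?thesis .
qed simp

section \<open>Densities and relative belief ratios for finitely many values of \<open>\<Psi>\<close>\<close>

text \<open>
  The standing hypotheses on the parameter of interest. The positivity condition makes conditioning
  on each value of \<open>\<Psi>\<close> meaningful and allows the prior mass to be cancelled in the risk.
\<close>

locale finite_bayes_model = bayes_model \<mu> \<nu> f \<pi> \<Psi> \<nu>\<Psi>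
  for \<mu> :: "'x measure" and \<nu> :: "'t measure" and f \<pi>
    and \<Psi> :: "'t \<Rightarrow> 'c" and \<nu>\<Psi> +
  assumes finite_values: "finite (\<Psi> ` space \<nu>)"
    and nu_Psi_counting: "\<nu>\<Psi> = count_space (\<Psi> ` space \<nu>)"
    and marginal_prior_density_pos:
      "\<And>\<psi>. \<psi> \<in> \<Psi> ` space \<nu> \<Longrightarrow> 0 < marginal_prior_density \<nu> \<pi> \<Psi> \<nu>\<Psi> \<psi>"
begin

abbreviation fibre :: "'c \<Rightarrow> 't set" where
  "fibre \<psi> \<equiv> {\<theta> \<in> space \<nu>. \<Psi> \<theta> = \<psi>}"

abbreviation prior_density :: "'c \<Rightarrow> ennreal" where
  "prior_density \<equiv> marginal_prior_density \<nu> \<pi> \<Psi> \<nu>\<Psi>"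

abbreviation cond_pred :: "'c \<Rightarrow> 'x \<Rightarrow> ennreal" where
  "cond_pred \<equiv> conditional_predictive_density \<nu> f \<pi> \<Psi>"

lemma prob_space_prior: "prob_space (prior \<nu> \<pi>)"
  using prior_proper by (simp add: prior_def)

lemma space_prior [simp]: "space (prior \<nu> \<pi>) = space \<nu>"
  and sets_prior [simp, measurable_cong]: "sets (prior \<nu> \<pi>) = sets \<nu>"
  by (simp_all add: prior_def)

lemma sets_conditional_prior [simp, measurable_cong]:
  "sets (conditional_prior \<nu> \<pi> \<Psi> \<psi>) = sets \<nu>"
  by (simp add: conditional_prior_def)

lemma fibre_eq_vimage: "fibre \<psi> = \<Psi> -` {\<psi>} \<inter> space \<nu>"
  by auto

lemma fibre_measurable: "\<psi> \<in> \<Psi> ` space \<nu> \<Longrightarrow> fibre \<psi> \<in> sets \<nu>"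
  unfolding fibre_eq_vimage
  by (rule measurable_sets[OF Psi_measurable]) (simp add: nu_Psi_counting)

lemma likelihood_measurable: "x \<in> space \<mu> \<Longrightarrow> (\<lambda>\<theta>. f \<theta> x) \<in> borel_measurable \<nu>"
  using measurable_compose[OF measurable_Pair2' f_measurable] by simp

lemma emeasure_distr_Psi:
  assumes "sets N = sets \<nu>" and "\<psi> \<in> \<Psi> ` space \<nu>"
  shows "emeasure (distr N \<nu>\<Psi> \<Psi>) {\<psi>} = emeasure N (fibre \<psi>)"
proof -
  have "\<Psi> \<in> measurable N \<nu>\<Psi>"
    using Psi_measurable measurable_cong_sets[OF assms(1) refl, of \<nu>\<Psi>] by simp
  then show ?thesis
    using assms sets_eq_imp_space_eq[OF assms(1)]
    by (subst emeasure_distr) (auto simp: nu_Psi_counting fibre_eq_vimage)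
qed

lemma RN_deriv_distr_Psi:
  assumes "sets N = sets \<nu>" and "\<psi> \<in> \<Psi> ` space \<nu>"
  shows "RN_deriv \<nu>\<Psi> (distr N \<nu>\<Psi> \<Psi>) \<psi> = emeasure N (fibre \<psi>)"
proof -
  have "RN_deriv \<nu>\<Psi> (distr N \<nu>\<Psi> \<Psi>) \<psi> = emeasure (distr N \<nu>\<Psi> \<Psi>) {\<psi>}"
    using assms(2) finite_values unfolding nu_Psi_counting
    by (intro RN_deriv_count_space) (auto intro: countable_finite)
  then show ?thesis
    using emeasure_distr_Psi[OF assms] by simp
qed

lemma prior_density_eq:
  "\<psi> \<in> \<Psi> ` space \<nu> \<Longrightarrow> prior_density \<psi> = emeasure (prior \<nu> \<pi>) (fibre \<psi>)"
  by (simp add: marginal_prior_density_def marginal_prior_def RN_deriv_distr_Psi)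

lemma prior_density_finite: "\<psi> \<in> \<Psi> ` space \<nu> \<Longrightarrow> prior_density \<psi> < \<infinity>"
proof -
  interpret prior: prob_space "prior \<nu> \<pi>" by (rule prob_space_prior)
  show "\<psi> \<in> \<Psi> ` space \<nu> \<Longrightarrow> prior_density \<psi> < \<infinity>"
    by (simp add: prior_density_eq less_top[symmetric])
qed

text \<open>
  The factor \<open>g\<close> is the constant 1 for the prior predictive density and the indicator of a fibre of
  \<open>\<Psi>\<close> for the conditional predictive densities.
\<close>

lemma nn_integral_prior:
  assumes "x \<in> space \<mu>" and "g \<in> borel_measurable \<nu>"
  shows "(\<integral>\<^sup>+\<theta>. ennreal (f \<theta> x) * g \<theta> \<partial>prior \<nu> \<pi>)
    = (\<integral>\<^sup>+\<theta>. ennreal (\<pi> \<theta> * f \<theta> x) * g \<theta> \<partial>\<nu>)"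
  unfolding prior_def using assms likelihood_measurable[OF assms(1)] prior_measurable
  by (subst nn_integral_density)
    (auto intro!: nn_integral_cong simp: ennreal_mult prior_nonneg f_nonneg mult.assoc)

lemma prior_predictive_eq:
  "x \<in> space \<mu> \<Longrightarrow> prior_predictive \<nu> f \<pi> x = (\<integral>\<^sup>+\<theta>. ennreal (f \<theta> x) \<partial>prior \<nu> \<pi>)"
  using nn_integral_prior[of x "\<lambda>_. 1"] by (simp add: prior_predictive_def)

lemma cond_pred_eq:
  assumes "x \<in> space \<mu>" and "\<psi> \<in> \<Psi> ` space \<nu>"
  shows "cond_pred \<psi> x
    = (\<integral>\<^sup>+\<theta>\<in>fibre \<psi>. ennreal (\<pi> \<theta> * f \<theta> x) \<partial>\<nu>) / prior_density \<psi>"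
  using assms fibre_measurable[OF assms(2)] likelihood_measurable[OF assms(1)]
  by (simp add: conditional_predictive_density_def conditional_prior_def
      nn_integral_uniform_measure prior_density_eq nn_integral_prior)

text \<open>
  Both sides are the integral of $\pi(\theta) f(x\,|\,\theta)$ over the fibre of \<open>\<psi>\<close>, divided by
  \<open>m(x)\<close> and by the prior mass of \<open>\<psi>\<close>; they differ in which division comes first. As
  \<open>ennreal\<close> division is multiplication by an inverse, this order is immaterial even where \<open>m(x)\<close>
  is \<open>0\<close> or \<open>\<infinity>\<close>.
\<close>

lemma relative_belief_ratio_eq:
  assumes "x \<in> space \<mu>" and "\<psi> \<in> \<Psi> ` space \<nu>"
  shows "relative_belief_ratio \<nu> f \<pi> \<Psi> \<nu>\<Psi> \<psi> x = cond_pred \<psi> x / prior_predictive \<nu> f \<pi> x"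
proof -
  let ?m = "prior_predictive \<nu> f \<pi> x"
  have "marginal_posterior_density \<nu> f \<pi> \<Psi> \<nu>\<Psi> x \<psi> = emeasure (posterior \<nu> f \<pi> x) (fibre \<psi>)"
    unfolding marginal_posterior_density_def marginal_posterior_def
    using assms(2) by (intro RN_deriv_distr_Psi) (simp_all add: posterior_def)
  also have "\<dots> = (\<integral>\<^sup>+\<theta>\<in>fibre \<psi>. ennreal (\<pi> \<theta> * f \<theta> x) / ?m \<partial>\<nu>)"
    unfolding posterior_def
    using fibre_measurable[OF assms(2)] likelihood_measurable[OF assms(1)] prior_measurable
    by (subst emeasure_density) auto
  also have "\<dots> = (\<integral>\<^sup>+\<theta>\<in>fibre \<psi>. ennreal (\<pi> \<theta> * f \<theta> x) \<partial>\<nu>) / ?m"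
    using fibre_measurable[OF assms(2)] likelihood_measurable[OF assms(1)] prior_measurable
    by (subst nn_integral_divide[symmetric])
      (auto intro!: nn_integral_cong simp: divide_ennreal_def mult_ac)
  finally show ?thesis
    using assms
    by (simp add: relative_belief_ratio_def cond_pred_eq divide_ennreal_def mult_ac)
qed

section \<open>The prior risk and its pointwise minimisation\<close>

lemma swapped_likelihood_measurable:
  "(\<lambda>(x, \<theta>). ennreal (f \<theta> x)) \<in> borel_measurable (\<mu> \<Otimes>\<^sub>M \<nu>)"
  using measurable_compose[OF measurable_pair_swap' f_measurable]
  by (auto simp: case_prod_beta)

lemma cond_pred_measurable:
  assumes "\<psi> \<in> \<Psi> ` space \<nu>"
  shows "cond_pred \<psi> \<in> borel_measurable \<mu>"
proof -
  interpret cond: prob_space "conditional_prior \<nu> \<pi> \<Psi> \<psi>"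
    unfolding conditional_prior_def
    using marginal_prior_density_pos[OF assms] prior_density_finite[OF assms]
    by (intro prob_space_uniform_measure) (auto simp: prior_density_eq[OF assms])
  have "(\<lambda>(x, \<theta>). ennreal (f \<theta> x)) \<in> borel_measurable (\<mu> \<Otimes>\<^sub>M conditional_prior \<nu> \<pi> \<Psi> \<psi>)"
    using swapped_likelihood_measurable
    by (simp cong: measurable_cong_sets sets_pair_measure_cong)
  then show ?thesis
    unfolding conditional_predictive_density_def
    by (rule cond.borel_measurable_nn_integral)
qed

text \<open>
  Integrating out \<open>x\<close> first turns each sampling density into 1, so \<open>m\<close> has total mass 1. Tonelli is
  applied to \<open>\<mu>\<close> and the prior probability measure, which is sigma-finite whatever \<open>\<nu>\<close> is.
\<close>

lemma AE_prior_predictive_finite: "AE x in \<mu>. prior_predictive \<nu> f \<pi> x < \<infinity>"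
proof -
  interpret prior: prob_space "prior \<nu> \<pi>" by (rule prob_space_prior)
  interpret pair_sigma_finite "prior \<nu> \<pi>" \<mu> ..
  let ?g = "\<lambda>x. \<integral>\<^sup>+\<theta>. ennreal (f \<theta> x) \<partial>prior \<nu> \<pi>"
  have meas: "(\<lambda>(x, \<theta>). ennreal (f \<theta> x)) \<in> borel_measurable (\<mu> \<Otimes>\<^sub>M prior \<nu> \<pi>)"
    using swapped_likelihood_measurable
    by (simp cong: measurable_cong_sets sets_pair_measure_cong)
  have meas': "(\<lambda>(\<theta>, x). ennreal (f \<theta> x)) \<in> borel_measurable (prior \<nu> \<pi> \<Otimes>\<^sub>M \<mu>)"
    using measurable_compose[OF measurable_pair_swap' meas]
    by (auto simp: case_prod_beta)
  have "(\<integral>\<^sup>+x. ?g x \<partial>\<mu>) = (\<integral>\<^sup>+\<theta>. (\<integral>\<^sup>+x. ennreal (f \<theta> x) \<partial>\<mu>) \<partial>prior \<nu> \<pi>)"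
    using Fubini'[OF meas'] by simp
  also have "\<dots> = (\<integral>\<^sup>+\<theta>. 1 \<partial>prior \<nu> \<pi>)"
  proof (rule nn_integral_cong)
    fix \<theta> assume "\<theta> \<in> space (prior \<nu> \<pi>)"
    then have \<theta>: "\<theta> \<in> space \<nu>" by simp
    have "(\<lambda>x. f \<theta> x) \<in> borel_measurable \<mu>"
      using measurable_compose[OF measurable_Pair1'[OF \<theta>] f_measurable] by simp
    then show "(\<integral>\<^sup>+x. ennreal (f \<theta> x) \<partial>\<mu>) = 1"
      using prob_space.emeasure_space_1[OF f_density[OF \<theta>]]
      by (simp add: emeasure_density cong: nn_integral_cong)
  qed
  also have "\<dots> = 1" by (simp add: prior.emeasure_space_1[simplified])
  finally have "(\<integral>\<^sup>+x. ?g x \<partial>\<mu>) \<noteq> \<infinity>" by simp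
  then have "AE x in \<mu>. ?g x \<noteq> \<infinity>"
    using prior.borel_measurable_nn_integral[OF meas] by (intro nn_integral_noteq_infinite) auto
  then show ?thesis
    by (rule AE_mp) (auto simp: prior_predictive_eq less_top[symmetric] intro!: AE_I2)
qed

text \<open>
  For each true value \<open>\<psi>\<close> the outer weight \<open>prior_density \<psi>\<close> meets its own reciprocal from the
  loss. What remains is the indicator of a wrong decision, which removes the single term
  \<open>\<psi> = \<delta> x\<close> from the sum over all values.
\<close>

lemma prior_risk_loss_RB:
  assumes "\<delta> \<in> measurable \<mu> \<nu>\<Psi>"
  shows "prior_risk \<mu> \<nu> f \<pi> \<Psi> \<nu>\<Psi> (loss_RB \<nu> \<pi> \<Psi> \<nu>\<Psi>) \<delta>
    = (\<integral>\<^sup>+x. (\<Sum>\<psi>\<in>\<Psi> ` space \<nu> - {\<delta> x}. cond_pred \<psi> x) \<partial>\<mu>)"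
proof -
  let ?C = "\<Psi> ` space \<nu>"
  let ?L = "\<lambda>\<psi> a. loss_on_Psi \<nu> \<Psi> (loss_RB \<nu> \<pi> \<Psi> \<nu>\<Psi>) \<psi> a"
  let ?I = "\<lambda>\<psi> x. indicator (- {\<delta> x}) \<psi> :: ennreal"
  have loss: "?L \<psi> a = indicator (- {a}) \<psi> / prior_density \<psi>" if "\<psi> \<in> ?C" for \<psi> a
    using that by (simp add: loss_on_Psi_def loss_RB_def f_inv_into_f)
  have comp_meas: "(\<lambda>x. F (\<delta> x)) \<in> borel_measurable \<mu>" for F :: "'c \<Rightarrow> ennreal"
    using assms unfolding nu_Psi_counting by (rule measurable_compose) simp
  have weighted: "prior_density \<psi> * (\<integral>\<^sup>+x. ?L \<psi> (\<delta> x) \<partial>conditional_predictive \<mu> \<nu> f \<pi> \<Psi> \<psi>)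
      = (\<integral>\<^sup>+x. cond_pred \<psi> x * ?I \<psi> x \<partial>\<mu>)" if \<psi>: "\<psi> \<in> ?C" for \<psi>
  proof -
    have cancel: "prior_density \<psi> * (b * (a / prior_density \<psi>)) = b * a" for a b
      using marginal_prior_density_pos[OF \<psi>] prior_density_finite[OF \<psi>]
      by (metis ennreal_mult_divide_eq ennreal_times_divide infinity_ennreal_def mult.commute
          order_less_irrefl)
    have "prior_density \<psi> * (\<integral>\<^sup>+x. ?L \<psi> (\<delta> x) \<partial>conditional_predictive \<mu> \<nu> f \<pi> \<Psi> \<psi>)
        = prior_density \<psi> * (\<integral>\<^sup>+x. cond_pred \<psi> x * ?L \<psi> (\<delta> x) \<partial>\<mu>)"
      unfolding conditional_predictive_def
      by (subst nn_integral_density) (auto intro: cond_pred_measurable \<psi> comp_meas)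
    also have "\<dots> = (\<integral>\<^sup>+x. prior_density \<psi> * (cond_pred \<psi> x * ?L \<psi> (\<delta> x)) \<partial>\<mu>)"
      by (subst nn_integral_cmult) (auto intro!: borel_measurable_times_ennreal cond_pred_measurable \<psi> comp_meas)
    finally show ?thesis by (simp add: loss[OF \<psi>] cancel)
  qed
  have "marginal_prior \<nu> \<pi> \<Psi> \<nu>\<Psi> = density (count_space ?C) prior_density"
  proof (rule measure_eqI_countable[of _ ?C])
    fix \<psi> assume "\<psi> \<in> ?C"
    then show "emeasure (marginal_prior \<nu> \<pi> \<Psi> \<nu>\<Psi>) {\<psi>}
        = emeasure (density (count_space ?C) prior_density) {\<psi>}"
      using finite_values
      by (simp add: marginal_prior_def emeasure_distr_Psi prior_density_eq emeasure_density
          nn_integral_count_space_finite)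
  qed (auto simp: marginal_prior_def nu_Psi_counting intro: countable_finite finite_values)
  then have "prior_risk \<mu> \<nu> f \<pi> \<Psi> \<nu>\<Psi> (loss_RB \<nu> \<pi> \<Psi> \<nu>\<Psi>) \<delta>
      = (\<Sum>\<psi>\<in>?C. prior_density \<psi>
          * (\<integral>\<^sup>+x. ?L \<psi> (\<delta> x) \<partial>conditional_predictive \<mu> \<nu> f \<pi> \<Psi> \<psi>))"
    using finite_values
    by (simp add: prior_risk_def nn_integral_density nn_integral_count_space_finite)
  also have "\<dots> = (\<Sum>\<psi>\<in>?C. \<integral>\<^sup>+x. cond_pred \<psi> x * ?I \<psi> x \<partial>\<mu>)"
    by (simp add: weighted)
  also have "\<dots> = (\<integral>\<^sup>+x. (\<Sum>\<psi>\<in>?C. cond_pred \<psi> x * ?I \<psi> x) \<partial>\<mu>)"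
    by (rule nn_integral_sum[symmetric])
      (intro borel_measurable_times_ennreal cond_pred_measurable comp_meas)
  also have "\<dots> = (\<integral>\<^sup>+x. (\<Sum>\<psi>\<in>?C - {\<delta> x}. cond_pred \<psi> x) \<partial>\<mu>)"
    using finite_values
    by (intro nn_integral_cong sum.mono_neutral_cong_right) (auto simp: indicator_def)
  finally show ?thesis .
qed

lemma cond_pred_zero:
  assumes "x \<in> space \<mu>" and "\<psi> \<in> \<Psi> ` space \<nu>" and "prior_predictive \<nu> f \<pi> x = 0"
  shows "cond_pred \<psi> x = 0"
proof -
  have "(\<integral>\<^sup>+\<theta>\<in>fibre \<psi>. ennreal (\<pi> \<theta> * f \<theta> x) \<partial>\<nu>) \<le> prior_predictive \<nu> f \<pi> x"
    unfolding prior_predictive_def by (intro nn_integral_mono) (auto simp: indicator_def)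
  then show ?thesis using assms by (simp add: cond_pred_eq)
qed

text \<open>
  Where \<open>0 < m(x) < \<infinity>\<close>, multiplying the relative belief ratios by \<open>m(x)\<close> recovers the conditional
  predictive densities; where \<open>m(x) = 0\<close> the choice of \<open>\<delta> x\<close> is unconstrained, but the left-hand
  side vanishes.
\<close>

lemma cond_pred_le_estimator:
  assumes \<delta>: "relative_belief_estimator \<mu> \<nu> f \<pi> \<Psi> \<nu>\<Psi> \<delta>"
    and x: "x \<in> space \<mu>" and fin: "prior_predictive \<nu> f \<pi> x < \<infinity>" and \<psi>: "\<psi> \<in> \<Psi> ` space \<nu>"
  shows "cond_pred \<psi> x \<le> cond_pred (\<delta> x) x"
proof (cases "prior_predictive \<nu> f \<pi> x = 0")
  case True
  then show ?thesis using x \<psi> by (simp add: cond_pred_zero)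
next
  case False
  let ?m = "prior_predictive \<nu> f \<pi> x"
  have "is_arg_max (\<lambda>\<psi>. relative_belief_ratio \<nu> f \<pi> \<Psi> \<nu>\<Psi> \<psi> x) (\<lambda>\<psi>. \<psi> \<in> \<Psi> ` space \<nu>) (\<delta> x)"
    using \<delta> x fin False by (auto simp: relative_belief_estimator_def zero_less_iff_neq_zero)
  then have "\<delta> x \<in> \<Psi> ` space \<nu>"
    and "relative_belief_ratio \<nu> f \<pi> \<Psi> \<nu>\<Psi> \<psi> x \<le> relative_belief_ratio \<nu> f \<pi> \<Psi> \<nu>\<Psi> (\<delta> x) x"
    using \<psi> by (auto simp: is_arg_max_linorder)
  then have "cond_pred \<psi> x / ?m \<le> cond_pred (\<delta> x) x / ?m"
    using x \<psi> by (simp add: relative_belief_ratio_eq)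
  then have "cond_pred \<psi> x / ?m * ?m \<le> cond_pred (\<delta> x) x / ?m * ?m"
    by (rule mult_right_mono) simp
  then show ?thesis
    using False fin by (simp add: ennreal_divide_times ennreal_mult_divide_eq)
qed

end

theorem theorem1:
  fixes \<mu> :: "'x measure"
    and \<nu> :: "'t measure"
    and f :: "'t \<Rightarrow> 'x \<Rightarrow> real"
    and \<pi> :: "'t \<Rightarrow> real"
    and \<Psi> :: "'t \<Rightarrow> 'c"
    and \<nu>\<Psi> :: "'c measure"
    and \<psi>_RB :: "'x \<Rightarrow> 'c"
  assumes "bayes_model \<mu> \<nu> f \<pi> \<Psi> \<nu>\<Psi>"
    and "finite (\<Psi> ` space \<nu>)"
    and "\<nu>\<Psi> = count_space (\<Psi> ` space \<nu>)"
    and "\<And>\<psi>. \<psi> \<in> \<Psi> ` space \<nu> \<Longrightarrow> 0 < marginal_prior_density \<nu> \<pi> \<Psi> \<nu>\<Psi> \<psi>"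
    and "relative_belief_estimator \<mu> \<nu> f \<pi> \<Psi> \<nu>\<Psi> \<psi>_RB"
  shows "bayes_rule \<mu> \<nu> f \<pi> \<Psi> \<nu>\<Psi> (loss_RB \<nu> \<pi> \<Psi> \<nu>\<Psi>) \<psi>_RB"
proof -
  interpret finite_bayes_model \<mu> \<nu> f \<pi> \<Psi> \<nu>\<Psi>
    using assms(1-4) by (simp add: finite_bayes_model_def finite_bayes_model_axioms_def)
  let ?C = "\<Psi> ` space \<nu>"
  have meas: "\<psi>_RB \<in> measurable \<mu> \<nu>\<Psi>"
    using assms(5) by (simp add: relative_belief_estimator_def)
  have range: "\<delta> x \<in> ?C" if "\<delta> \<in> measurable \<mu> \<nu>\<Psi>" "x \<in> space \<mu>" for \<delta> x
    using measurable_space[OF that] by (simp add: space_nu_Psi)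
  show ?thesis
    unfolding bayes_rule_def
  proof (intro conjI ballI)
    fix \<delta> assume \<delta>: "\<delta> \<in> measurable \<mu> \<nu>\<Psi>"
    have "AE x in \<mu>. (\<Sum>\<psi>\<in>?C - {\<psi>_RB x}. cond_pred \<psi> x) \<le> (\<Sum>\<psi>\<in>?C - {\<delta> x}. cond_pred \<psi> x)"
      using AE_prior_predictive_finite
    proof (rule AE_mp, intro AE_I2 impI)
      fix x assume x: "x \<in> space \<mu>" "prior_predictive \<nu> f \<pi> x < \<infinity>"
      show "(\<Sum>\<psi>\<in>?C - {\<psi>_RB x}. cond_pred \<psi> x) \<le> (\<Sum>\<psi>\<in>?C - {\<delta> x}. cond_pred \<psi> x)"
        using range[OF meas x(1)] range[OF \<delta> x(1)]
        by (intro sum_remove_le_sum_remove finite_values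
            cond_pred_le_estimator[OF assms(5) x])
    qed
    then show "prior_risk \<mu> \<nu> f \<pi> \<Psi> \<nu>\<Psi> (loss_RB \<nu> \<pi> \<Psi> \<nu>\<Psi>) \<psi>_RB
        \<le> prior_risk \<mu> \<nu> f \<pi> \<Psi> \<nu>\<Psi> (loss_RB \<nu> \<pi> \<Psi> \<nu>\<Psi>) \<delta>"
      unfolding prior_risk_loss_RB[OF meas] prior_risk_loss_RB[OF \<delta>]
      by (rule nn_integral_mono_AE)
  qed (rule meas)
qed

end
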